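(* Let $K$ be a (not necessarily commutative) ring with unit and let $S$ be a Hausdorff étale semicategory such that $S^2$ is closed in $S\times S$. If $f,g\in KS$ then the convolution $fg$ also lies in $KS$. Thus $KS$ forms a $K$-algebra under convolution.
   Context: **Semicategories.** A semigroupoid is a set $S$ with a product defined on some pairs $S^2\subseteq S\times S$ such that $(ab)c$ is defined iff $a(bc)$ is defined, in which case they are equal. Its units are $S^0=\{u\in S:\forall a\in S\ [(u,a)\in S^2\Rightarrow ua=a]\text{ and }[(a,u)\in S^2\Rightarrow au=a]\}$. The source unit $\mathsf s(a)$ of $a$ is the (unique, if it exists) $u\in S^0$ with $(a,u)\in S^2$; the range unit $\mathsf r(a)$ is the (unique, if it exists) $u\in S^0$ with $(u,a)\in S^2$. $S$ is a semicategory if every $a\in S$ has a source unit and $S^2=\{(a,b):\mathsf r(b)\text{ exists and }\mathsf s(a)=\mathsf r(b)\}$. $S^0S$ denotes the set of elements having a range unit. **Étale.** A semicategory with a topology is topological if $\mathsf s$ (on $S$), $\mathsf r$ (on $S^0S$) and the product (on $S^2$) are continuous. It is étale if it is topological, $S^0S$ is open in $S$ and $\mathsf s$ is a locally injective open map (into $S$; equivalently a local homeomorphism onto the open subset $S^0$). **$K$-algebras.** A $K$-algebra is a $K$-bimodule $A$ with a product $A\times A\to A$ that is distributive over addition and associative on $K\times A\times A$, $A\times K\times A$, $A\times A\times K$ and $A\times A\times A$. **$KS$.** $KS$ is the $K$-bimodule (pointwise sums, left and right scalar products) of functions $f:S\to K$ that are locally constant, i.e. continuous with respect to the discrete topology on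 $K$, and compactly supported, i.e. $\{s: f(s)\neq0\}$ is contained in a compact set. The convolution of $f,g\in KS$ is $(fg)(a)=\sum_{a=bc}f(b)g(c)$, the sum being over $(b,c)\in S^2$ with $bc=a$ (only finitely many terms are non-zero). *)

theory Defs
  imports "HOL-Analysis.Analysis" "HOL-Library.Function_Algebras"
begin

text \<open>A partial product on \<open>S\<close> is a total function \<open>(\<cdot>)\<close> together with the set \<open>D\<close> (the set
  \<open>S\<^sup>2\<close>) of pairs on which it is defined; values of \<open>(\<cdot>)\<close> outside \<open>D\<close> are irrelevant.\<close>

locale semigroupoid =
  fixes S :: "'a set" and D :: "('a \<times> 'a) set" and mul :: "'a \<Rightarrow> 'a \<Rightarrow> 'a" (infixl "\<cdot>" 70)
  assumes dom_subset: "D \<subseteq> S \<times> S"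
    and mult_closed: "(a, b) \<in> D \<Longrightarrow> a \<cdot> b \<in> S"
    and assoc_defined_iff:
      "\<lbrakk>a \<in> S; b \<in> S; c \<in> S\<rbrakk> \<Longrightarrow>
        (a, b) \<in> D \<and> (a \<cdot> b, c) \<in> D \<longleftrightarrow> (b, c) \<in> D \<and> (a, b \<cdot> c) \<in> D"
    and assoc:
      "\<lbrakk>(a, b) \<in> D; (a \<cdot> b, c) \<in> D\<rbrakk> \<Longrightarrow> (a \<cdot> b) \<cdot> c = a \<cdot> (b \<cdot> c)"
begin

definition units :: "'a set" where
  "units = {u \<in> S. \<forall>a\<in>S. ((u, a) \<in> D \<longrightarrow> u \<cdot> a = a) \<and> ((a, u) \<in> D \<longrightarrow> a \<cdot> u = a)}"

definition has_source :: "'a \<Rightarrow> bool" where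
  "has_source a \<longleftrightarrow> (\<exists>u\<in>units. (a, u) \<in> D)"

definition has_range :: "'a \<Rightarrow> bool" where
  "has_range a \<longleftrightarrow> (\<exists>u\<in>units. (u, a) \<in> D)"

text \<open>The units in the next two definitions are unique whenever they exist: if \<open>u\<close>, \<open>v\<close> are units
  with \<open>(a, u), (a, v) \<in> D\<close>, then \<open>(a \<cdot> u) \<cdot> v\<close> is defined, hence so is \<open>u \<cdot> v\<close>, and
  \<open>u = u \<cdot> v = v\<close>.\<close>

definition source :: "'a \<Rightarrow> 'a" where
  "source a = (THE u. u \<in> units \<and> (a, u) \<in> D)"

definition range_unit :: "'a \<Rightarrow> 'a" where
  "range_unit a = (THE u. u \<in> units \<and> (u, a) \<in> D)"

text \<open>The set \<open>S\<^sup>0S\<close>.\<close>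

definition ranged :: "'a set" where
  "ranged = {a \<in> S. has_range a}"

end

locale semicategory = semigroupoid +
  assumes all_have_source: "a \<in> S \<Longrightarrow> has_source a"
    and dom_eq: "D = {(a, b). a \<in> S \<and> b \<in> S \<and> has_range b \<and> source a = range_unit b}"

locale topological_semicategory = semicategory "topspace X" D mul
  for X :: "'a topology" and D and mul (infixl "\<cdot>" 70) +
  assumes continuous_source: "continuous_map X X source"
    and continuous_range: "continuous_map (subtopology X ranged) X range_unit"
    and continuous_mult:
      "continuous_map (subtopology (prod_topology X X) D) X (\<lambda>(a, b). a \<cdot> b)"

locale etale_semicategory = topological_semicategory +
  assumes open_ranged: "openin X ranged"
    and open_map_source: "open_map X X source"
    and locally_inj_source:
      "a \<in> topspace X \<Longrightarrow> \<exists>U. openin X U \<and> a \<in> U \<and> inj_on source U"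

text \<open>Bimodules and algebras over \<open>K\<close> live on a subset \<open>A\<close> of an additive group.  The sort
  \<open>{ring, monoid_mult}\<close> is that of rings with unit; unlike \<open>ring_1\<close>, it admits the zero ring.\<close>

locale K_bimodule =
  fixes A :: "'m::ab_group_add set"
    and lscale :: "'k::{ring, monoid_mult} \<Rightarrow> 'm \<Rightarrow> 'm"
    and rscale :: "'m \<Rightarrow> 'k \<Rightarrow> 'm"
  assumes zero_closed: "0 \<in> A"
    and add_closed: "\<lbrakk>x \<in> A; y \<in> A\<rbrakk> \<Longrightarrow> x + y \<in> A"
    and uminus_closed: "x \<in> A \<Longrightarrow> - x \<in> A"
    and lscale_closed: "x \<in> A \<Longrightarrow> lscale k x \<in> A"
    and rscale_closed: "x \<in> A \<Longrightarrow> rscale x k \<in> A"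
    and lscale_add: "\<lbrakk>x \<in> A; y \<in> A\<rbrakk> \<Longrightarrow> lscale k (x + y) = lscale k x + lscale k y"
    and add_lscale: "x \<in> A \<Longrightarrow> lscale (k + l) x = lscale k x + lscale l x"
    and lscale_lscale: "x \<in> A \<Longrightarrow> lscale (k * l) x = lscale k (lscale l x)"
    and one_lscale: "x \<in> A \<Longrightarrow> lscale 1 x = x"
    and rscale_add: "\<lbrakk>x \<in> A; y \<in> A\<rbrakk> \<Longrightarrow> rscale (x + y) k = rscale x k + rscale y k"
    and add_rscale: "x \<in> A \<Longrightarrow> rscale x (k + l) = rscale x k + rscale x l"
    and rscale_rscale: "x \<in> A \<Longrightarrow> rscale x (k * l) = rscale (rscale x k) l"
    and rscale_one: "x \<in> A \<Longrightarrow> rscale x 1 = x"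
    and lscale_rscale: "x \<in> A \<Longrightarrow> rscale (lscale k x) l = lscale k (rscale x l)"

locale K_algebra = K_bimodule A lscale rscale
  for A :: "'m::ab_group_add set"
    and lscale :: "'k::{ring, monoid_mult} \<Rightarrow> 'm \<Rightarrow> 'm"
    and rscale :: "'m \<Rightarrow> 'k \<Rightarrow> 'm" +
  fixes prd :: "'m \<Rightarrow> 'm \<Rightarrow> 'm"
  assumes prd_closed: "\<lbrakk>x \<in> A; y \<in> A\<rbrakk> \<Longrightarrow> prd x y \<in> A"
    and prd_add_left: "\<lbrakk>x \<in> A; y \<in> A; z \<in> A\<rbrakk> \<Longrightarrow> prd (x + y) z = prd x z + prd y z"
    and prd_add_right: "\<lbrakk>x \<in> A; y \<in> A; z \<in> A\<rbrakk> \<Longrightarrow> prd x (y + z) = prd x y + prd x z"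
    and assoc_KAA: "\<lbrakk>x \<in> A; y \<in> A\<rbrakk> \<Longrightarrow> prd (lscale k x) y = lscale k (prd x y)"
    and assoc_AKA: "\<lbrakk>x \<in> A; y \<in> A\<rbrakk> \<Longrightarrow> prd (rscale x k) y = prd x (lscale k y)"
    and assoc_AAK: "\<lbrakk>x \<in> A; y \<in> A\<rbrakk> \<Longrightarrow> rscale (prd x y) k = prd x (rscale y k)"
    and assoc_AAA: "\<lbrakk>x \<in> A; y \<in> A; z \<in> A\<rbrakk> \<Longrightarrow> prd (prd x y) z = prd x (prd y z)"

text \<open>A function \<open>S \<rightarrow> K\<close> is represented by its extension by \<open>0\<close> outside \<open>S = topspace X\<close>.\<close>

definition KS :: "'a topology \<Rightarrow> ('a \<Rightarrow> 'k::{ring, monoid_mult}) set" where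
  "KS X = {f. (\<forall>s. s \<notin> topspace X \<longrightarrow> f s = 0)
            \<and> continuous_map X (discrete_topology UNIV) f
            \<and> (\<exists>C. compactin X C \<and> {s. f s \<noteq> 0} \<subseteq> C)}"

definition left_scalar :: "'k::{ring, monoid_mult} \<Rightarrow> ('a \<Rightarrow> 'k) \<Rightarrow> ('a \<Rightarrow> 'k)" where
  "left_scalar k f = (\<lambda>s. k * f s)"

definition right_scalar :: "('a \<Rightarrow> 'k::{ring, monoid_mult}) \<Rightarrow> 'k \<Rightarrow> ('a \<Rightarrow> 'k)" where
  "right_scalar f k = (\<lambda>s. f s * k)"

text \<open>The index set of the non-zero terms of the convolution sum at \<open>a\<close>; the set of all
  factorizations of \<open>a\<close> may be infinite, and \<open>sum\<close> over an infinite set is \<open>0\<close> by convention.\<close>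

definition nonzero_factorizations ::
  "('a \<times> 'a) set \<Rightarrow> ('a \<Rightarrow> 'a \<Rightarrow> 'a) \<Rightarrow> ('a \<Rightarrow> 'k::{ring, monoid_mult}) \<Rightarrow> ('a \<Rightarrow> 'k) \<Rightarrow> 'a
    \<Rightarrow> ('a \<times> 'a) set" where
  "nonzero_factorizations D mul f g a = {(b, c) \<in> D. mul b c = a \<and> f b * g c \<noteq> 0}"

definition convolution ::
  "('a \<times> 'a) set \<Rightarrow> ('a \<Rightarrow> 'a \<Rightarrow> 'a) \<Rightarrow> ('a \<Rightarrow> 'k::{ring, monoid_mult}) \<Rightarrow> ('a \<Rightarrow> 'k)
    \<Rightarrow> ('a \<Rightarrow> 'k)" where
  "convolution D mul f g =
    (\<lambda>a. \<Sum>(b, c) \<in> nonzero_factorizations D mul f g a. f b * g c)"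

end

theory Submission
  imports Defs
begin

text \<open>The product \<open>D \<rightarrow> S\<close> is a local homeomorphism: the source of \<open>b \<cdot> c\<close> is that of \<open>c\<close>, so
  \<open>b \<cdot> c\<close> determines \<open>c\<close>, and then \<open>b\<close>, as long as both stay in sets on which the source is
  injective.  The convolution of \<open>f\<close> and \<open>g\<close> is the push-forward along this map of the locally
  constant function \<open>(b, c) \<mapsto> f b * g c\<close> on \<open>D\<close>, which has compact support because \<open>D\<close> is closed.
  Over a small neighbourhood of a point, the part of each fibre that meets the support consists of
  exactly one point on each of finitely many disjoint sheets, so the push-forward is locally
  constant.\<close>

section \<open>Locally constant functions with compact support\<close>

text \<open>Points are open in the discrete topology, so the fibre of \<open>f\<close> through
  \<open>s\<close> is itself an open neighbourhood of \<open>s\<close>. The neighbourhood form is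
  the one in which membership in \<open>KS\<close> is used and verified below.\<close>

lemma continuous_map_discrete_iff_locally_constant:
  "continuous_map X (discrete_topology UNIV) f \<longleftrightarrow>
    (\<forall>s\<in>topspace X. \<exists>U. openin X U \<and> s \<in> U \<and> (\<forall>t\<in>U. f t = f s))"
  (is "?L \<longleftrightarrow> ?R")
proof
  assume f: ?L
  show ?R
  proof
    fix s assume "s \<in> topspace X"
    moreover have "openin X {t \<in> topspace X. f t \<in> {f s}}"
      using f by (rule openin_continuous_map_preimage) simp
    ultimately show "\<exists>U. openin X U \<and> s \<in> U \<and> (\<forall>t\<in>U. f t = f s)"
      by (intro exI[of _ "{t \<in> topspace X. f t \<in> {f s}}"]) auto
  qed
next
  assume R: ?R
  have "openin X {s \<in> topspace X. f s \<in> V}" for V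
  proof (subst openin_subopen, intro ballI)
    fix s assume s: "s \<in> {s \<in> topspace X. f s \<in> V}"
    then obtain U where U: "openin X U" "s \<in> U" "\<forall>t\<in>U. f t = f s"
      using R by blast
    have "t \<in> {s \<in> topspace X. f s \<in> V}" if "t \<in> U" for t
      using bspec[OF U(3) that] openin_subset[OF U(1)] that s by auto
    then show "\<exists>T. openin X T \<and> s \<in> T \<and> T \<subseteq> {s \<in> topspace X. f s \<in> V}"
      using U(1,2) by blast
  qed
  then show ?L
    by (auto simp: continuous_map_def)
qed

lemma KS_I:
  assumes "\<And>s. s \<notin> topspace X \<Longrightarrow> f s = 0"
    and "\<And>s. s \<in> topspace X \<Longrightarrow> \<exists>U. openin X U \<and> s \<in> U \<and> (\<forall>t\<in>U. f t = f s)"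
    and "compactin X C" and "{s. f s \<noteq> 0} \<subseteq> C"
  shows "f \<in> KS X"
  using assms unfolding KS_def continuous_map_discrete_iff_locally_constant by auto

lemma KS_outside: "f \<in> KS X \<Longrightarrow> s \<notin> topspace X \<Longrightarrow> f s = 0"
  unfolding KS_def by auto

lemma KS_locally_constant:
  assumes "f \<in> KS X" and "s \<in> topspace X"
  obtains U where "openin X U" "s \<in> U" "\<And>t. t \<in> U \<Longrightarrow> f t = f s"
  using assms unfolding KS_def continuous_map_discrete_iff_locally_constant by blast

text \<open>The definition of \<open>KS\<close> only provides a compact superset. The support is
  also closed, being the preimage of a closed set of the discrete space, so it is itself
  compact.\<close>

lemma compactin_KS_support:
  assumes "f \<in> KS X"
  shows "compactin X {s. f s \<noteq> 0}"
proof -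
  obtain C where C: "compactin X C" "{s. f s \<noteq> 0} \<subseteq> C"
    using assms unfolding KS_def by auto
  have f: "continuous_map X (discrete_topology UNIV) f"
    using assms unfolding KS_def by auto
  have "closedin X {s \<in> topspace X. f s \<in> UNIV - {0}}"
    using f by (rule closedin_continuous_map_preimage) simp
  moreover have "{s \<in> topspace X. f s \<in> UNIV - {0}} = {s. f s \<noteq> 0}"
    using KS_outside[OF assms] by auto
  ultimately show ?thesis
    using C closed_compactin by metis
qed

section \<open>Pointwise operations on \<open>KS\<close>\<close>

lemma KS_zero: "(\<lambda>_. 0) \<in> KS X"
  by (rule KS_I[where C = "{}"]) auto

text \<open>Serves all pointwise operations at once; unary ones arise by taking \<open>g\<close>
  equal to \<open>f\<close> and ignoring the second argument. The condition on \<open>\<phi>\<close>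
  keeps the support inside the union of the two supports.\<close>

lemma KS_combine:
  fixes f g :: "'a \<Rightarrow> 'k::{ring, monoid_mult}"
  assumes f: "f \<in> KS X" and g: "g \<in> KS X" and "\<phi> 0 0 = 0"
  shows "(\<lambda>s. \<phi> (f s) (g s)) \<in> KS X"
proof (rule KS_I)
  show "compactin X ({s. f s \<noteq> 0} \<union> {s. g s \<noteq> 0})"
    using compactin_KS_support[OF f] compactin_KS_support[OF g] by (rule compactin_Un)
  show "{s. \<phi> (f s) (g s) \<noteq> 0} \<subseteq> {s. f s \<noteq> 0} \<union> {s. g s \<noteq> 0}"
    using \<open>\<phi> 0 0 = 0\<close> by auto
  fix s
  show "s \<notin> topspace X \<Longrightarrow> \<phi> (f s) (g s) = 0"
    using assms by (simp add: KS_outside)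
  assume s: "s \<in> topspace X"
  obtain U where U: "openin X U" "s \<in> U" "\<And>t. t \<in> U \<Longrightarrow> f t = f s"
    using KS_locally_constant[OF f s] by blast
  obtain V where V: "openin X V" "s \<in> V" "\<And>t. t \<in> V \<Longrightarrow> g t = g s"
    using KS_locally_constant[OF g s] by blast
  show "\<exists>U. openin X U \<and> s \<in> U \<and> (\<forall>t\<in>U. \<phi> (f t) (g t) = \<phi> (f s) (g s))"
    using U V by (intro exI[of _ "U \<inter> V"]) (metis IntD1 IntD2 IntI openin_Int)
qed

lemma K_bimodule_KS:
  "K_bimodule (KS X :: ('a \<Rightarrow> 'k::{ring, monoid_mult}) set) left_scalar right_scalar"
proof
  show "0 \<in> (KS X :: ('a \<Rightarrow> 'k) set)"
    using KS_zero by (simp add: zero_fun_def)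
  fix f g :: "'a \<Rightarrow> 'k" and k :: 'k
  assume f: "f \<in> KS X"
  show "- f \<in> KS X"
    using KS_combine[OF f f, of "\<lambda>x _. - x"] by (simp add: fun_Compl_def)
  show "left_scalar k f \<in> KS X"
    using KS_combine[OF f f, of "\<lambda>x _. k * x"] by (simp add: left_scalar_def)
  show "right_scalar f k \<in> KS X"
    using KS_combine[OF f f, of "\<lambda>x _. x * k"] by (simp add: right_scalar_def)
  assume g: "g \<in> KS X"
  show "f + g \<in> KS X"
    using KS_combine[OF f g, of "(+)"] by (simp add: plus_fun_def)
qed (auto simp: left_scalar_def right_scalar_def fun_eq_iff algebra_simps)

section \<open>Push-forward along a local homeomorphism\<close>

text \<open>Open sets on which \<open>m\<close> is injective cover \<open>C\<close>, so finitely
  many do, and each contains at most one point of the fibre.\<close>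

lemma finite_fibre_compactin:
  assumes "\<And>p. p \<in> topspace Y \<Longrightarrow> \<exists>U. openin Y U \<and> p \<in> U \<and> inj_on m U"
    and "compactin Y C"
  shows "finite {p \<in> C. m p = a}"
proof -
  have "C \<subseteq> \<Union>{U. openin Y U \<and> inj_on m U}"
    using assms compactin_subset_topspace by blast
  then obtain \<F> where \<F>: "finite \<F>" "\<F> \<subseteq> {U. openin Y U \<and> inj_on m U}" "C \<subseteq> \<Union>\<F>"
    using compactinD[OF assms(2), of "{U. openin Y U \<and> inj_on m U}"] by auto
  have "finite {p \<in> U. m p = a}" if "inj_on m U" for U
  proof (cases "{p \<in> U. m p = a} = {}")
    case False
    then obtain q where "q \<in> U" "m q = a"
      by blast
    then have "{p \<in> U. m p = a} \<subseteq> {q}"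
      using that by (auto dest: inj_onD)
    then show ?thesis
      using finite_subset by blast
  qed (simp only: finite.emptyI)
  then have "finite (\<Union>U\<in>\<F>. {p \<in> U. m p = a})"
    using \<F> by auto
  moreover have "{p \<in> C. m p = a} \<subseteq> (\<Union>U\<in>\<F>. {p \<in> U. m p = a})"
    using \<F>(3) by auto
  ultimately show ?thesis
    by (rule rev_finite_subset)
qed

lemma Hausdorff_space_separate_finite:
  assumes "Hausdorff_space Y" and "finite P" and "P \<subseteq> topspace Y"
  obtains W where "\<And>p. p \<in> P \<Longrightarrow> openin Y (W p) \<and> p \<in> W p"
    and "\<And>p q. p \<in> P \<Longrightarrow> q \<in> P \<Longrightarrow> p \<noteq> q \<Longrightarrow> W p \<inter> W q = {}"
proof -
  have "\<forall>p q. \<exists>U V. p \<in> P \<and> q \<in> P \<and> p \<noteq> q \<longrightarrow>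
      openin Y U \<and> openin Y V \<and> p \<in> U \<and> q \<in> V \<and> U \<inter> V = {}"
    using assms(1,3) unfolding Hausdorff_space_def disjnt_def by (meson subsetD)
  then obtain U V where UV: "\<And>p q. p \<in> P \<Longrightarrow> q \<in> P \<Longrightarrow> p \<noteq> q \<Longrightarrow>
      openin Y (U p q) \<and> openin Y (V p q) \<and> p \<in> U p q \<and> q \<in> V p q \<and> U p q \<inter> V p q = {}"
    by metis
  \<comment> \<open>The separating sets chosen for \<open>(p, q)\<close> and for
    \<open>(q, p)\<close> are unrelated, so \<open>W p\<close> must lie both in \<open>U p q\<close>
    and in \<open>V q p\<close>. The factor \<open>topspace Y\<close> covers the case
    \<open>P = {p}\<close>, where the intersection over the empty index set is
    \<open>UNIV\<close>.\<close>
  define W where "W p = topspace Y \<inter> (\<Inter>q\<in>P - {p}. U p q \<inter> V q p)" for p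
  show thesis
  proof (rule that[of W])
    fix p assume p: "p \<in> P"
    have "openin Y (W p)"
    proof (cases "P - {p} = {}")
      case False
      have "openin Y (\<Inter>q\<in>P - {p}. U p q \<inter> V q p)"
        using UV p \<open>finite P\<close> False by (intro openin_INT2) auto
      then show ?thesis
        unfolding W_def by auto
    qed (simp only: W_def, simp)
    then show "openin Y (W p) \<and> p \<in> W p"
      using UV p assms(3) by (auto simp: W_def)
    fix q assume q: "q \<in> P" "p \<noteq> q"
    then have "W p \<subseteq> U p q" "W q \<subseteq> V p q"
      using p by (auto simp: W_def)
    then show "W p \<inter> W q = {}"
      using UV[OF p q] by blast
  qed
qed

text \<open>Applied below with \<open>m\<close> the product on composable pairs. Continuity makes
  the image of the support compact, openness makes the image of each sheet a neighbourhood, and the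
  two Hausdorff conditions separate the sheets in \<open>Y\<close> and make compact images closed in
  \<open>X\<close>.\<close>

proposition pushforward_in_KS:
  fixes h :: "'b \<Rightarrow> 'k::{ring, monoid_mult}"
  assumes Y: "Hausdorff_space Y" and X: "Hausdorff_space X"
    and cont: "continuous_map Y X m" and om: "open_map Y X m"
    and inj: "\<And>p. p \<in> topspace Y \<Longrightarrow> \<exists>U. openin Y U \<and> p \<in> U \<and> inj_on m U"
    and h: "h \<in> KS Y"
  shows "(\<lambda>a. \<Sum>p | m p = a \<and> h p \<noteq> 0. h p) \<in> KS X"
proof (rule KS_I)
  define H where "H = {p. h p \<noteq> 0}"
  have cH: "compactin Y H"
    unfolding H_def using h by (rule compactin_KS_support)
  have HY: "H \<subseteq> topspace Y"
    using cH by (rule compactin_subset_topspace)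
  have mY: "m p \<in> topspace X" if "p \<in> topspace Y" for p
    using cont that by (auto simp: continuous_map_def)
  show "compactin X (m ` H)"
    using cH cont by (rule image_compactin)
  show "{a. (\<Sum>p | m p = a \<and> h p \<noteq> 0. h p) \<noteq> 0} \<subseteq> m ` H"
  proof -
    have "(\<Sum>p | m p = a \<and> h p \<noteq> 0. h p) = 0" if "a \<notin> m ` H" for a
      using that by (intro sum.neutral) (auto simp: H_def)
    then show ?thesis
      by blast
  qed
  fix a
  show "(\<Sum>p | m p = a \<and> h p \<noteq> 0. h p) = 0" if "a \<notin> topspace X"
    using that mY HY unfolding H_def by (intro sum.neutral) auto
  assume a: "a \<in> topspace X"
  define P where "P = {p \<in> H. m p = a}"
  have P: "finite P" "P \<subseteq> topspace Y"
    using finite_fibre_compactin[OF inj cH] HY by (auto simp: P_def)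
  obtain W where W: "\<And>p. p \<in> P \<Longrightarrow> openin Y (W p) \<and> p \<in> W p"
    "\<And>p q. p \<in> P \<Longrightarrow> q \<in> P \<Longrightarrow> p \<noteq> q \<Longrightarrow> W p \<inter> W q = {}"
    using Hausdorff_space_separate_finite[OF Y P] by blast
  \<comment> \<open>The sheet through \<open>p\<close>: \<open>m\<close> is injective and
    \<open>h\<close> constant on it, and lying in \<open>W p\<close> makes it disjoint from the
    sheets through the other points of \<open>P\<close>.\<close>
  have "\<exists>U. openin Y U \<and> p \<in> U \<and> U \<subseteq> W p \<and> inj_on m U \<and> (\<forall>q\<in>U. h q = h p)"
    if p: "p \<in> P" for p
  proof -
    obtain U where U: "openin Y U" "p \<in> U" "inj_on m U"
      using inj P p by blast
    obtain V where V: "openin Y V" "p \<in> V" "\<And>q. q \<in> V \<Longrightarrow> h q = h p"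
      using KS_locally_constant[OF h] P p by blast
    show ?thesis
      using U V W(1)[OF p] by (intro exI[of _ "U \<inter> V \<inter> W p"]) (blast intro: inj_on_subset)
  qed
  then obtain B where B: "\<And>p. p \<in> P \<Longrightarrow> openin Y (B p)" "\<And>p. p \<in> P \<Longrightarrow> p \<in> B p"
    "\<And>p. p \<in> P \<Longrightarrow> B p \<subseteq> W p" "\<And>p. p \<in> P \<Longrightarrow> inj_on m (B p)"
    "\<And>p q. p \<in> P \<Longrightarrow> q \<in> B p \<Longrightarrow> h q = h p"
    by metis
  \<comment> \<open>The first factor forces every support point over \<open>N\<close> into some
    sheet; it is open because the removed set is the image of a compact set. The second factor
    ensures that every sheet has a point over each element of \<open>N\<close>. If \<open>P\<close>
    is empty, the second factor is \<open>UNIV\<close>.\<close>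
  define N where "N = (topspace X - m ` (H - (\<Union>p\<in>P. B p))) \<inter> (\<Inter>p\<in>P. m ` B p)"
  have oN: "openin X N"
  proof -
    have "compactin Y (H \<inter> (topspace Y - (\<Union>p\<in>P. B p)))"
      using cH B(1) by (intro compact_Int_closedin) auto
    moreover have "H \<inter> (topspace Y - (\<Union>p\<in>P. B p)) = H - (\<Union>p\<in>P. B p)"
      using HY by auto
    ultimately have "compactin X (m ` (H - (\<Union>p\<in>P. B p)))"
      using cont image_compactin by metis
    then have "openin X (topspace X - m ` (H - (\<Union>p\<in>P. B p)))"
      using X compactin_imp_closedin by blast
    moreover have "openin X (m ` B p)" if "p \<in> P" for p
      using om B(1) that by (auto simp: open_map_def)
    ultimately show ?thesis
      using P(1) unfolding N_def by (cases "P = {}") (auto intro!: openin_Int openin_INT2)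
  qed
  have aN: "a \<in> N"
    using a B(2) by (auto simp: N_def P_def)
  have eq: "(\<Sum>p | m p = a' \<and> h p \<noteq> 0. h p) = (\<Sum>p\<in>P. h p)" if a': "a' \<in> N" for a'
  proof -
    have "\<exists>q. q \<in> B p \<and> m q = a'" if "p \<in> P" for p
      using a' that by (auto simp: N_def)
    \<comment> \<open>\<open>\<sigma> p\<close> is the point over \<open>a'\<close> on the sheet
      through \<open>p\<close>. It will turn out that \<open>\<sigma>\<close> is a bijection from
      \<open>P\<close> onto the support points over \<open>a'\<close> and preserves the values of
      \<open>h\<close>.\<close>
    then obtain \<sigma> where \<sigma>: "\<And>p. p \<in> P \<Longrightarrow> \<sigma> p \<in> B p" "\<And>p. p \<in> P \<Longrightarrow> m (\<sigma> p) = a'"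
      by metis
    have h\<sigma>: "h (\<sigma> p) = h p" if "p \<in> P" for p
      using that \<sigma>(1) by (intro B(5))
    have "inj_on \<sigma> P"
    proof (rule inj_onI, rule ccontr)
      fix p q assume "p \<in> P" "q \<in> P" "\<sigma> p = \<sigma> q" "p \<noteq> q"
      then show False
        using W(2) B(3) \<sigma>(1) by (metis disjoint_iff subsetD)
    qed
    moreover have "\<sigma> ` P = {p. m p = a' \<and> h p \<noteq> 0}"
    proof
      show "\<sigma> ` P \<subseteq> {p. m p = a' \<and> h p \<noteq> 0}"
      proof (rule image_subsetI)
        fix p assume p: "p \<in> P"
        then have "h p \<noteq> 0"
          by (simp add: P_def H_def)
        then show "\<sigma> p \<in> {p. m p = a' \<and> h p \<noteq> 0}"
          using \<sigma>(2)[OF p] h\<sigma>[OF p] by simp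
      qed
      show "{p. m p = a' \<and> h p \<noteq> 0} \<subseteq> \<sigma> ` P"
      proof
        fix q assume q: "q \<in> {p. m p = a' \<and> h p \<noteq> 0}"
        then have "q \<in> (\<Union>p\<in>P. B p)"
          using a' by (auto simp: N_def H_def)
        then obtain p where p: "p \<in> P" "q \<in> B p"
          by blast
        then have "q = \<sigma> p"
          using B(4) \<sigma> q by (auto dest!: inj_onD)
        then show "q \<in> \<sigma> ` P"
          using p by blast
      qed
    qed
    ultimately have "(\<Sum>p | m p = a' \<and> h p \<noteq> 0. h p) = (\<Sum>p\<in>P. h (\<sigma> p))"
      by (metis (no_types, lifting) sum.reindex_cong)
    also have "\<dots> = (\<Sum>p\<in>P. h p)"
      using h\<sigma> by (rule sum.cong[OF refl])
    finally show ?thesis .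
  qed
  show "\<exists>U. openin X U \<and> a \<in> U \<and>
      (\<forall>t\<in>U. (\<Sum>p | m p = t \<and> h p \<noteq> 0. h p) = (\<Sum>p | m p = a \<and> h p \<noteq> 0. h p))"
    using oN aN eq by (intro exI[of _ N]) auto
qed

lemma openin_prod_topology_box:
  assumes "openin (prod_topology X Y) Q" and "(x, y) \<in> Q"
  obtains U V where "openin X U" "openin Y V" "x \<in> U" "y \<in> V" "U \<times> V \<subseteq> Q"
  using assms(1)[unfolded openin_prod_topology_alt, rule_format, OF assms(2)] by blast

section \<open>The product of an etale semicategory is a local homeomorphism\<close>

context semigroupoid
begin

lemma source_unique:
  assumes "u \<in> units" "v \<in> units" "(a, u) \<in> D" "(a, v) \<in> D"
  shows "u = v"
proof -
  have S: "a \<in> S" "u \<in> S" "v \<in> S"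
    using assms dom_subset by auto
  have "a \<cdot> u = a"
    using assms S by (auto simp: units_def)
  then have "(u, v) \<in> D"
    using assoc_defined_iff[OF S] assms by auto
  then show ?thesis
    using assms S by (auto simp: units_def)
qed

lemma source_eqI: "u \<in> units \<Longrightarrow> (a, u) \<in> D \<Longrightarrow> source a = u"
  unfolding source_def using source_unique by blast

end

context semicategory
begin

lemma source_props:
  assumes "a \<in> S"
  shows "source a \<in> units" and "(a, source a) \<in> D"
  using all_have_source[OF assms] source_eqI unfolding has_source_def by auto

text \<open>Since \<open>c \<cdot> source c = c\<close>, the bracketing of \<open>b\<close>,
  \<open>c\<close>, \<open>source c\<close> to the right is defined; hence so is the one to the
  left, which makes \<open>source c\<close> a source unit of \<open>b \<cdot> c\<close>.\<close>

lemma source_mul: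
  assumes "(b, c) \<in> D"
  shows "source (b \<cdot> c) = source c"
proof -
  have S: "b \<in> S" "c \<in> S"
    using assms dom_subset by auto
  have u: "source c \<in> units" "(c, source c) \<in> D"
    using source_props S by auto
  then have "source c \<in> S" "c \<cdot> source c = c"
    using S by (auto simp: units_def)
  then have "(b \<cdot> c, source c) \<in> D"
    using assoc_defined_iff[OF S, of "source c"] assms u by auto
  then show ?thesis
    using source_eqI u by blast
qed

lemma source_eq_range: "(b, c) \<in> D \<Longrightarrow> source b = range_unit c"
  using dom_eq by auto

text \<open>The factors are recovered from right to left: the product has the source of
  \<open>c\<close>, which fixes \<open>c\<close> in \<open>V\<close>, and the range unit of
  \<open>c\<close> is the source of \<open>b\<close>, which fixes \<open>b\<close> in
  \<open>U\<close>.\<close>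

lemma mul_inj_on:
  assumes "inj_on source U" "inj_on source V"
  shows "inj_on (\<lambda>(b, c). b \<cdot> c) (D \<inter> U \<times> V)"
proof (rule inj_onI, clarify)
  fix b c b' c'
  assume bc: "(b, c) \<in> D" "b \<in> U" "c \<in> V" and bc': "(b', c') \<in> D" "b' \<in> U" "c' \<in> V"
    and eq: "b \<cdot> c = b' \<cdot> c'"
  have "source c = source c'"
    using source_mul[OF bc(1)] source_mul[OF bc'(1)] eq by simp
  then have "c = c'"
    using assms(2) bc bc' by (auto dest: inj_onD)
  moreover from this have "source b = source b'"
    using source_eq_range[OF bc(1)] source_eq_range[OF bc'(1)] by simp
  then have "b = b'"
    using assms(1) bc bc' by (auto dest: inj_onD)
  ultimately show "b = b' \<and> c = c'"
    by simp
qed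

end

section \<open>The product as an open, locally injective map on composable pairs\<close>

context etale_semicategory
begin

abbreviation composable :: "('a \<times> 'a) topology" where
  "composable \<equiv> subtopology (prod_topology X X) D"

lemma topspace_composable: "topspace composable = D"
  using dom_subset by auto

lemma openin_composable_times:
  "openin X U \<Longrightarrow> openin X V \<Longrightarrow> openin composable (D \<inter> U \<times> V)"
  unfolding openin_subtopology
  by (intro exI[of _ "U \<times> V"]) (auto simp: openin_prod_Times_iff)

lemma locally_inj_mul:
  assumes "p \<in> topspace composable"
  shows "\<exists>U. openin composable U \<and> p \<in> U \<and> inj_on (\<lambda>(b, c). b \<cdot> c) U"
proof -
  obtain b c where p: "p = (b, c)" "(b, c) \<in> D"
    using assms topspace_composable by (cases p) auto
  then have bc: "b \<in> topspace X" "c \<in> topspace X"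
    using dom_subset by auto
  obtain U where "openin X U" "b \<in> U" "inj_on source U"
    using locally_inj_source bc by blast
  moreover obtain V where "openin X V" "c \<in> V" "inj_on source V"
    using locally_inj_source bc by blast
  ultimately show ?thesis
    using p by (intro exI[of _ "D \<inter> U \<times> V"]) (simp add: openin_composable_times mul_inj_on)
qed

text \<open>A nearby \<open>w\<close> is factorized by matching sources: some composable
  \<open>b'\<close>, \<open>c'\<close> close to \<open>b\<close>, \<open>c\<close> have a product
  with the source of \<open>w\<close>, and local injectivity of \<open>source\<close> near
  \<open>b \<cdot> c\<close> forces that product to be \<open>w\<close>.\<close>

lemma mul_image_neighbourhood:
  assumes U: "openin X U" "b \<in> U" and V: "openin X V" "c \<in> V" and bc: "(b, c) \<in> D"
  shows "\<exists>T. openin X T \<and> b \<cdot> c \<in> T \<and> T \<subseteq> (\<lambda>(b, c). b \<cdot> c) ` (D \<inter> U \<times> V)"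
proof -
  obtain W where W: "openin X W" "b \<cdot> c \<in> W" "inj_on source W"
    using locally_inj_source mult_closed[OF bc] by blast
  have "openin composable {p \<in> topspace composable. (case p of (b, c) \<Rightarrow> b \<cdot> c) \<in> W}"
    using continuous_mult W(1) by (rule openin_continuous_map_preimage)
  then obtain Q where Q: "openin (prod_topology X X) Q"
    "{p \<in> topspace composable. (case p of (b, c) \<Rightarrow> b \<cdot> c) \<in> W} = Q \<inter> D"
    unfolding openin_subtopology by blast
  have "(b, c) \<in> Q \<inter> D"
    unfolding Q(2)[symmetric] topspace_composable using bc W(2) by simp
  then have "(b, c) \<in> Q"
    by blast
  then obtain U1 V1 where UV1: "openin X U1" "openin X V1" "b \<in> U1" "c \<in> V1" "U1 \<times> V1 \<subseteq> Q"
    using openin_prod_topology_box[OF Q(1)] by blast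
  \<comment> \<open>By continuity of the product, factors in \<open>U1\<close> and \<open>V1\<close>
    keep the product in \<open>W\<close>, where \<open>source\<close> is injective.\<close>
  have inW: "b' \<cdot> c' \<in> W" if "(b', c') \<in> D" "b' \<in> U1" "c' \<in> V1" for b' c'
  proof -
    have "(b', c') \<in> Q \<inter> D"
      using that UV1(5) by blast
    then show ?thesis
      unfolding Q(2)[symmetric] by simp
  qed
  \<comment> \<open>The elements of \<open>V\<close> and \<open>V1\<close> that have a left partner
    in \<open>U \<inter> U1\<close>. The set is open because \<open>source\<close> is an open map,
    \<open>range_unit\<close> is continuous on \<open>ranged\<close>, and \<open>ranged\<close> is
    open in \<open>X\<close>.\<close>
  define V2 where "V2 = {c' \<in> ranged. range_unit c' \<in> source ` (U \<inter> U1)} \<inter> (V \<inter> V1)"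
  have "openin X (source ` (U \<inter> U1))"
    using open_map_source U UV1 by (auto simp: open_map_def)
  then have "openin (subtopology X ranged)
      {c' \<in> topspace (subtopology X ranged). range_unit c' \<in> source ` (U \<inter> U1)}"
    by (rule openin_continuous_map_preimage[OF continuous_range])
  then have "openin X {c' \<in> ranged. range_unit c' \<in> source ` (U \<inter> U1)}"
    using openin_subset[OF open_ranged]
    by (simp add: openin_open_subtopology[OF open_ranged] Int_absorb1)
  then have "openin X V2"
    unfolding V2_def using V UV1 by auto
  then have oV2: "openin X (source ` V2)"
    using open_map_source by (auto simp: open_map_def)
  \<comment> \<open>The second factor supplies \<open>c'\<close> in \<open>V2\<close> with the
    source of \<open>w\<close>; membership in \<open>W\<close> allows \<open>w\<close> to be
    compared with \<open>b' \<cdot> c'\<close>.\<close>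
  define T where "T = W \<inter> {w \<in> topspace X. source w \<in> source ` V2}"
  have "openin X T"
    unfolding T_def using W(1) openin_continuous_map_preimage[OF continuous_source oV2] by auto
  moreover have "b \<cdot> c \<in> T"
  proof -
    have "c \<in> ranged"
      using bc dom_eq unfolding ranged_def by auto
    then have "c \<in> V2"
      using source_eq_range[OF bc] U V UV1 unfolding V2_def by (auto intro!: image_eqI[of _ _ b])
    then show ?thesis
      using W(2) mult_closed[OF bc] source_mul[OF bc] unfolding T_def by auto
  qed
  moreover have "T \<subseteq> (\<lambda>(b, c). b \<cdot> c) ` (D \<inter> U \<times> V)"
  proof
    fix w assume w: "w \<in> T"
    then obtain c' where c': "c' \<in> V2" "source w = source c'"
      unfolding T_def by auto
    then obtain b' where b': "b' \<in> U \<inter> U1" "range_unit c' = source b'"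
      unfolding V2_def by auto
    have D': "(b', c') \<in> D"
      using b' c' openin_subset[OF U(1)] by (subst dom_eq) (auto simp: V2_def ranged_def)
    have "b' \<cdot> c' \<in> W"
      using inW[OF D'] b' c' by (auto simp: V2_def)
    moreover have "source (b' \<cdot> c') = source w"
      using source_mul[OF D'] c' by simp
    ultimately have "w = b' \<cdot> c'"
      using W(3) w by (auto simp: T_def dest: inj_onD)
    then show "w \<in> (\<lambda>(b, c). b \<cdot> c) ` (D \<inter> U \<times> V)"
      using D' b' c' by (auto simp: V2_def intro!: image_eqI[of _ _ "(b', c')"])
  qed
  ultimately show ?thesis
    by blast
qed

lemma open_map_mul: "open_map composable X (\<lambda>(b, c). b \<cdot> c)"
  unfolding open_map_def
proof (intro allI impI)
  fix O' assume "openin composable O'"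
  then obtain Q where Q: "openin (prod_topology X X) Q" "O' = Q \<inter> D"
    unfolding openin_subtopology by blast
  show "openin X ((\<lambda>(b, c). b \<cdot> c) ` O')"
  proof (subst openin_subopen, clarify)
    fix b c assume bc: "(b, c) \<in> O'"
    then have "(b, c) \<in> Q"
      using Q(2) by blast
    then obtain U V where UV: "openin X U" "openin X V" "b \<in> U" "c \<in> V" "U \<times> V \<subseteq> Q"
      using openin_prod_topology_box[OF Q(1)] by blast
    then have sub: "(\<lambda>(b, c). b \<cdot> c) ` (D \<inter> U \<times> V) \<subseteq> (\<lambda>(b, c). b \<cdot> c) ` O'"
      using Q(2) by (intro image_mono) auto
    have "(b, c) \<in> D"
      using bc Q(2) by blast
    then obtain T where T: "openin X T" "b \<cdot> c \<in> T"
      "T \<subseteq> (\<lambda>(b, c). b \<cdot> c) ` (D \<inter> U \<times> V)"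
      using mul_image_neighbourhood[OF UV(1,3) UV(2,4)] by metis
    show "\<exists>T. openin X T \<and> b \<cdot> c \<in> T \<and> T \<subseteq> (\<lambda>(b, c). b \<cdot> c) ` O'"
      using T(1,2) order_trans[OF T(3) sub] by (intro exI[of _ T] conjI)
  qed
qed

end

section \<open>Convolution\<close>

locale closed_etale_semicategory = etale_semicategory +
  assumes Hausdorff: "Hausdorff_space X"
    and closed_dom: "closedin (prod_topology X X) D"
begin

text \<open>Depends on two sets rather than on the functions themselves, so that several
  convolutions can be summed over one common index set.\<close>

definition factorizations :: "'a set \<Rightarrow> 'a set \<Rightarrow> 'a \<Rightarrow> ('a \<times> 'a) set" where
  "factorizations F G a = {(b, c) \<in> D. b \<in> F \<and> c \<in> G \<and> b \<cdot> c = a}"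

text \<open>This is where \<open>closed_dom\<close> enters: a closed subset of the compact
  \<open>F \<times> G\<close> is compact.\<close>

lemma compactin_composable:
  assumes "compactin X F" "compactin X G"
  shows "compactin composable (D \<inter> F \<times> G)"
proof -
  have "compactin (prod_topology X X) (D \<inter> F \<times> G)"
    using assms closed_dom by (intro closed_Int_compactin) (auto simp: compactin_Times)
  then show ?thesis
    by (simp add: compactin_subtopology)
qed

lemma finite_factorizations:
  assumes "compactin X F" "compactin X G"
  shows "finite (factorizations F G a)"
proof -
  have "finite {p \<in> D \<inter> F \<times> G. (\<lambda>(b, c). b \<cdot> c) p = a}"
    using finite_fibre_compactin[OF locally_inj_mul compactin_composable[OF assms]] .
  then show ?thesis
    by (rule rev_finite_subset) (auto simp: factorizations_def)
qed

lemma finite_nonzero_factorizations: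
  fixes f g :: "'a \<Rightarrow> 'k::{ring, monoid_mult}"
  assumes "f \<in> KS X" "g \<in> KS X"
  shows "finite (nonzero_factorizations D (\<cdot>) f g a)"
  using finite_factorizations[OF assms[THEN compactin_KS_support], of a]
  by (rule rev_finite_subset) (auto simp: nonzero_factorizations_def factorizations_def)

text \<open>The additional terms vanish, and there are finitely many of them. The freedom to enlarge
  \<open>F\<close> and \<open>G\<close> is what makes the two sides of each algebra law comparable
  term by term.\<close>

lemma convolution_eq_sum:
  fixes f g :: "'a \<Rightarrow> 'k::{ring, monoid_mult}"
  assumes "compactin X F" "compactin X G" "{s. f s \<noteq> 0} \<subseteq> F" "{s. g s \<noteq> 0} \<subseteq> G"
  shows "convolution D (\<cdot>) f g a = (\<Sum>(b, c)\<in>factorizations F G a. f b * g c)"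
  unfolding convolution_def
proof (rule sum.mono_neutral_left)
  show "finite (factorizations F G a)"
    using assms by (simp add: finite_factorizations)
  show "nonzero_factorizations D (\<cdot>) f g a \<subseteq> factorizations F G a"
  proof clarify
    fix b c assume bc: "(b, c) \<in> nonzero_factorizations D (\<cdot>) f g a"
    then have "f b \<noteq> 0" "g c \<noteq> 0"
      by (auto simp: nonzero_factorizations_def)
    then show "(b, c) \<in> factorizations F G a"
      using bc assms by (auto simp: nonzero_factorizations_def factorizations_def)
  qed
  show "\<forall>i\<in>factorizations F G a - nonzero_factorizations D (\<cdot>) f g a.
      (case i of (b, c) \<Rightarrow> f b * g c) = 0"
    by (auto simp: nonzero_factorizations_def factorizations_def)
qed

lemma convolution_in_KS:
  fixes f g :: "'a \<Rightarrow> 'k::{ring, monoid_mult}"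
  assumes f: "f \<in> KS X" and g: "g \<in> KS X"
  shows "convolution D (\<cdot>) f g \<in> KS X"
proof -
  \<comment> \<open>The function to be pushed forward; it is \<open>0\<close> off \<open>D\<close>,
    as membership in \<open>KS composable\<close> requires, so its support over \<open>a\<close> is
    exactly the index set of the convolution at \<open>a\<close>.\<close>
  define h where "h p = (if p \<in> D then f (fst p) * g (snd p) else 0)" for p
  have h: "h \<in> KS composable"
  proof (rule KS_I)
    show "compactin composable (D \<inter> {s. f s \<noteq> 0} \<times> {s. g s \<noteq> 0})"
      using f g by (intro compactin_composable compactin_KS_support)
    show "{s. h s \<noteq> 0} \<subseteq> D \<inter> {s. f s \<noteq> 0} \<times> {s. g s \<noteq> 0}"
      by (auto simp: h_def split: if_splits)
    fix p
    show "h p = 0" if "p \<notin> topspace composable"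
      using that unfolding topspace_composable by (simp add: h_def)
    assume "p \<in> topspace composable"
    then have p: "p \<in> D"
      using topspace_composable by blast
    then have bc: "fst p \<in> topspace X" "snd p \<in> topspace X"
      using dom_subset by auto
    obtain U where U: "openin X U" "fst p \<in> U" "\<And>t. t \<in> U \<Longrightarrow> f t = f (fst p)"
      using KS_locally_constant[OF f bc(1)] by blast
    obtain V where V: "openin X V" "snd p \<in> V" "\<And>t. t \<in> V \<Longrightarrow> g t = g (snd p)"
      using KS_locally_constant[OF g bc(2)] by blast
    have "p \<in> D \<inter> U \<times> V"
      using p U(2) V(2) by (cases p) auto
    moreover have "\<forall>t\<in>D \<inter> U \<times> V. h t = h p"
    proof
      fix t assume t: "t \<in> D \<inter> U \<times> V"
      then have "f (fst t) = f (fst p)" "g (snd t) = g (snd p)"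
        by (auto intro: U(3) V(3))
      then show "h t = h p"
        using p t by (simp add: h_def)
    qed
    ultimately show "\<exists>U. openin composable U \<and> p \<in> U \<and> (\<forall>t\<in>U. h t = h p)"
      using openin_composable_times[OF U(1) V(1)] by blast
  qed
  have "Hausdorff_space composable"
    using Hausdorff by (simp add: Hausdorff_space_subtopology Hausdorff_space_prod_topology)
  then have "(\<lambda>a. \<Sum>p | (\<lambda>(b, c). b \<cdot> c) p = a \<and> h p \<noteq> 0. h p) \<in> KS X"
    using Hausdorff continuous_mult open_map_mul locally_inj_mul h by (rule pushforward_in_KS)
  moreover have "convolution D (\<cdot>) f g = (\<lambda>a. \<Sum>p | (\<lambda>(b, c). b \<cdot> c) p = a \<and> h p \<noteq> 0. h p)"
    unfolding convolution_def
    by (intro ext sum.cong) (auto simp: h_def nonzero_factorizations_def split: if_splits)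
  ultimately show ?thesis
    by simp
qed

text \<open>Both sides expand to sums over triples \<open>x\<close>, \<open>y\<close>,
  \<open>z\<close> with product \<open>a\<close>, and associativity of the partial product matches
  the two ways of bracketing them.\<close>

lemma convolution_assoc:
  fixes f g h :: "'a \<Rightarrow> 'k::{ring, monoid_mult}"
  assumes f: "f \<in> KS X" and g: "g \<in> KS X" and h: "h \<in> KS X"
  shows "convolution D (\<cdot>) (convolution D (\<cdot>) f g) h
    = convolution D (\<cdot>) f (convolution D (\<cdot>) g h)"
proof
  fix a
  define F where "F = {s. f s \<noteq> 0}"
  define G where "G = {s. g s \<noteq> 0}"
  define H where "H = {s. h s \<noteq> 0}"
  have c: "compactin X F" "compactin X G" "compactin X H"
    unfolding F_def G_def H_def using f g h by (simp_all add: compactin_KS_support)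
  define m where "m = (\<lambda>(b, c). b \<cdot> c)"
  have cont: "continuous_map composable X m"
    unfolding m_def by (rule continuous_mult)
  \<comment> \<open>Compact sets containing the supports of the two inner convolutions, so that the
    outer convolutions also become finite sums over \<open>factorizations\<close>.\<close>
  define FG where "FG = m ` (D \<inter> F \<times> G)"
  define GH where "GH = m ` (D \<inter> G \<times> H)"
  have c': "compactin X FG" "compactin X GH"
    unfolding FG_def GH_def using image_compactin[OF compactin_composable cont] c by auto
  have supp: "{s. convolution D (\<cdot>) f g s \<noteq> 0} \<subseteq> FG" "{s. convolution D (\<cdot>) g h s \<noteq> 0} \<subseteq> GH"
  proof -
    have "convolution D (\<cdot>) f g s = 0" if "s \<notin> FG" for s
      unfolding convolution_eq_sum[OF c(1,2) F_def[THEN equalityD2] G_def[THEN equalityD2]]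
      using that by (intro sum.neutral) (force simp: factorizations_def FG_def m_def)
    then show "{s. convolution D (\<cdot>) f g s \<noteq> 0} \<subseteq> FG"
      by blast
    have "convolution D (\<cdot>) g h s = 0" if "s \<notin> GH" for s
      unfolding convolution_eq_sum[OF c(2,3) G_def[THEN equalityD2] H_def[THEN equalityD2]]
      using that by (intro sum.neutral) (force simp: factorizations_def GH_def m_def)
    then show "{s. convolution D (\<cdot>) g h s \<noteq> 0} \<subseteq> GH"
      by blast
  qed
  \<comment> \<open>Mutually inverse rebracketings. The ignored components \<open>d\<close> and
    \<open>e\<close> equal \<open>x \<cdot> y\<close> and \<open>y \<cdot> z\<close> on the index
    sets, so no information is lost.\<close>
  define j where "j = (\<lambda>((d::'a, z::'a), (x::'a, y::'a)). ((x, y \<cdot> z), (y, z)))"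
  define i where "i = (\<lambda>((x::'a, e::'a), (y::'a, z::'a)). ((x \<cdot> y, z), (x, y)))"
  have "convolution D (\<cdot>) (convolution D (\<cdot>) f g) h a
      = (\<Sum>(d, z)\<in>factorizations FG H a. convolution D (\<cdot>) f g d * h z)"
    by (rule convolution_eq_sum) (use c c' supp H_def in auto)
  also have "\<dots> = (\<Sum>p\<in>factorizations FG H a. \<Sum>q\<in>factorizations F G (fst p).
      f (fst q) * g (snd q) * h (snd p))"
    unfolding convolution_eq_sum[OF c(1,2) F_def[THEN equalityD2] G_def[THEN equalityD2]]
    by (simp add: sum_distrib_right case_prod_unfold)
  also have "\<dots> = (\<Sum>(p, q)\<in>(SIGMA p : factorizations FG H a. factorizations F G (fst p)).
      f (fst q) * g (snd q) * h (snd p))"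
    using c c' by (intro sum.Sigma) (auto simp: finite_factorizations)
  also have "\<dots> = (\<Sum>(p, q)\<in>(SIGMA p : factorizations F GH a. factorizations G H (snd p)).
      f (fst p) * (g (fst q) * h (snd q)))"
  proof (rule sum.reindex_bij_witness[where j = j and i = i])
    fix t assume "t \<in> (SIGMA p : factorizations FG H a. factorizations F G (fst p))"
    then obtain x y z where t: "t = ((x \<cdot> y, z), (x, y))" "(x, y) \<in> D" "(x \<cdot> y, z) \<in> D"
      "x \<in> F" "y \<in> G" "z \<in> H" "(x \<cdot> y) \<cdot> z = a"
      by (auto simp: factorizations_def)
    have "x \<in> topspace X" "y \<in> topspace X" "z \<in> topspace X"
      using t dom_subset by auto
    then have D: "(y, z) \<in> D" "(x, y \<cdot> z) \<in> D"
      using assoc_defined_iff t by blast+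
    have "y \<cdot> z \<in> GH"
      using D t by (force simp: GH_def m_def)
    then show "j t \<in> (SIGMA p : factorizations F GH a. factorizations G H (snd p))"
      using t D assoc[OF t(2,3)] by (auto simp: j_def factorizations_def)
    show "i (j t) = t"
      using t by (simp add: i_def j_def)
    show "(case j t of (p, q) \<Rightarrow> f (fst p) * (g (fst q) * h (snd q)))
      = (case t of (p, q) \<Rightarrow> f (fst q) * g (snd q) * h (snd p))"
      using t by (simp add: j_def mult.assoc)
  next
    fix t assume "t \<in> (SIGMA p : factorizations F GH a. factorizations G H (snd p))"
    then obtain x y z where t: "t = ((x, y \<cdot> z), (y, z))" "(y, z) \<in> D" "(x, y \<cdot> z) \<in> D"
      "x \<in> F" "y \<in> G" "z \<in> H" "x \<cdot> (y \<cdot> z) = a"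
      by (auto simp: factorizations_def)
    have "x \<in> topspace X" "y \<in> topspace X" "z \<in> topspace X"
      using t dom_subset by auto
    then have D: "(x, y) \<in> D" "(x \<cdot> y, z) \<in> D"
      using assoc_defined_iff t by blast+
    have "x \<cdot> y \<in> FG"
      using D t by (force simp: FG_def m_def)
    then show "i t \<in> (SIGMA p : factorizations FG H a. factorizations F G (fst p))"
      using t D assoc[OF D] by (auto simp: i_def factorizations_def)
    show "j (i t) = t"
      using t by (simp add: i_def j_def)
  qed
  also have "\<dots> = (\<Sum>p\<in>factorizations F GH a. \<Sum>q\<in>factorizations G H (snd p).
      f (fst p) * (g (fst q) * h (snd q)))"
    using c c' by (intro sum.Sigma[symmetric]) (auto simp: finite_factorizations)
  also have "\<dots> = (\<Sum>(x, e)\<in>factorizations F GH a. f x * convolution D (\<cdot>) g h e)"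
    unfolding convolution_eq_sum[OF c(2,3) G_def[THEN equalityD2] H_def[THEN equalityD2]]
    by (simp add: sum_distrib_left case_prod_unfold)
  also have "\<dots> = convolution D (\<cdot>) f (convolution D (\<cdot>) g h) a"
    by (rule convolution_eq_sum[symmetric]) (use c c' supp F_def in auto)
  finally show "convolution D (\<cdot>) (convolution D (\<cdot>) f g) h a
    = convolution D (\<cdot>) f (convolution D (\<cdot>) g h) a" .
qed

lemma K_algebra_KS:
  "K_algebra (KS X :: ('a \<Rightarrow> 'k::{ring, monoid_mult}) set) left_scalar right_scalar
    (convolution D (\<cdot>))"
proof (intro K_algebra.intro K_bimodule_KS K_algebra_axioms.intro)
  fix f g :: "'a \<Rightarrow> 'k" and k :: 'k
  assume f: "f \<in> KS X" and g: "g \<in> KS X"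
  show "convolution D (\<cdot>) f g \<in> KS X"
    using f g by (rule convolution_in_KS)
  define F where "F = {s. f s \<noteq> 0}"
  define G where "G = {s. g s \<noteq> 0}"
  have c: "compactin X F" "compactin X G"
    unfolding F_def G_def using f g by (simp_all add: compactin_KS_support)
  \<comment> \<open>Scaling does not enlarge supports, so the three laws involving scalars can all
    be checked on \<open>factorizations F G\<close>.\<close>
  have sub: "{s. f s \<noteq> 0} \<subseteq> F" "{s. g s \<noteq> 0} \<subseteq> G"
    "{s. left_scalar k f s \<noteq> 0} \<subseteq> F" "{s. left_scalar k g s \<noteq> 0} \<subseteq> G"
    "{s. right_scalar f k s \<noteq> 0} \<subseteq> F" "{s. right_scalar g k s \<noteq> 0} \<subseteq> G"
    by (auto simp: F_def G_def left_scalar_def right_scalar_def)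
  note conv = convolution_eq_sum[OF c sub(1,2)]
  show "convolution D (\<cdot>) (left_scalar k f) g = left_scalar k (convolution D (\<cdot>) f g)"
    by (rule ext, subst convolution_eq_sum[OF c sub(3,2)])
      (simp add: conv left_scalar_def sum_distrib_left case_prod_unfold mult.assoc)
  show "convolution D (\<cdot>) (right_scalar f k) g = convolution D (\<cdot>) f (left_scalar k g)"
    by (rule ext, subst convolution_eq_sum[OF c sub(5,2)], subst convolution_eq_sum[OF c sub(1,4)])
      (simp add: left_scalar_def right_scalar_def mult.assoc)
  show "right_scalar (convolution D (\<cdot>) f g) k = convolution D (\<cdot>) f (right_scalar g k)"
    by (rule ext, subst convolution_eq_sum[OF c sub(1,6)])
      (simp add: conv right_scalar_def sum_distrib_right case_prod_unfold mult.assoc)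
  fix h :: "'a \<Rightarrow> 'k"
  assume h: "h \<in> KS X"
  define H where "H = {s. h s \<noteq> 0}"
  have "compactin X H"
    unfolding H_def using h by (rule compactin_KS_support)
  \<comment> \<open>For distributivity the index set must serve both summands and their sum, hence
    the unions.\<close>
  then have c': "compactin X (F \<union> G)" "compactin X H" "compactin X F" "compactin X (G \<union> H)"
    using c by (auto intro: compactin_Un)
  have sub': "{s. (f + g) s \<noteq> 0} \<subseteq> F \<union> G" "{s. f s \<noteq> 0} \<subseteq> F \<union> G" "{s. g s \<noteq> 0} \<subseteq> F \<union> G"
    "{s. h s \<noteq> 0} \<subseteq> H" "{s. (g + h) s \<noteq> 0} \<subseteq> G \<union> H" "{s. g s \<noteq> 0} \<subseteq> G \<union> H"
    "{s. h s \<noteq> 0} \<subseteq> G \<union> H"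
    by (auto simp: F_def G_def H_def)
  show "convolution D (\<cdot>) (f + g) h = convolution D (\<cdot>) f h + convolution D (\<cdot>) g h"
    by (rule ext) (simp add: convolution_eq_sum[OF c'(1,2) sub'(1,4)]
        convolution_eq_sum[OF c'(1,2) sub'(2,4)] convolution_eq_sum[OF c'(1,2) sub'(3,4)]
        sum.distrib case_prod_unfold distrib_right)
  show "convolution D (\<cdot>) f (g + h) = convolution D (\<cdot>) f g + convolution D (\<cdot>) f h"
    by (rule ext) (simp add: convolution_eq_sum[OF c'(3,4) sub(1) sub'(5)]
        convolution_eq_sum[OF c'(3,4) sub(1) sub'(6)] convolution_eq_sum[OF c'(3,4) sub(1) sub'(7)]
        sum.distrib case_prod_unfold distrib_left)
  show "convolution D (\<cdot>) (convolution D (\<cdot>) f g) h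
      = convolution D (\<cdot>) f (convolution D (\<cdot>) g h)"
    using f g h by (rule convolution_assoc)
qed

end

theorem theorem5p3:
  fixes X :: "'a topology"
    and D :: "('a \<times> 'a) set"
    and mul :: "'a \<Rightarrow> 'a \<Rightarrow> 'a"
  assumes "etale_semicategory X D mul"
    and "Hausdorff_space X"
    and "closedin (prod_topology X X) D"
  shows "(\<forall>f \<in> KS X. \<forall>g \<in> (KS X :: ('a \<Rightarrow> 'k::{ring, monoid_mult}) set).
            (\<forall>a \<in> topspace X. finite (nonzero_factorizations D mul f g a)) \<and>
            convolution D mul f g \<in> KS X)
       \<and> K_algebra (KS X :: ('a \<Rightarrow> 'k) set) left_scalar right_scalar (convolution D mul)"
proof -
  interpret closed_etale_semicategory X D mul
    using assms by (simp add: closed_etale_semicategory_def closed_etale_semicategory_axioms_def)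
  show ?thesis
    using finite_nonzero_factorizations convolution_in_KS K_algebra_KS by blast
qed

end
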